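(* Let $R$ be a unique factorization domain, let $k\ge2$ and $n$ be integers such that some prime factor of $n$ has multiplicity at least $k$ in $n$, and let $q_k$ be the smallest prime factor of $n$ with multiplicity $\ge k$. Let $f(s)=\sum_{i=1}^n\frac{a_i}{i^s}$ be a Dirichlet polynomial of degree $n$ with coefficients in $R$. If $f$ has a nonzero coefficient $a_i$ with $n-\min\{n_{<k},q_k\}\,q_k^{k-1}<i<n$, then $f$ is $k$-power-free.
   Context: Dirichlet polynomials are multiplied by the Dirichlet product $\left(\sum_j\frac{b_j}{j^s}\right)\left(\sum_k\frac{c_k}{k^s}\right)=\sum_i\frac{\sum_{jk=i}b_jc_k}{i^s}$; constant means supported on $\{1\}$; the degree is the largest index with nonzero coefficient. $n_{<k}=\prod_{p \text{ prime},\ \nu_p(n)<k}p^{\nu_p(n)}$ (empty product $=1$), where $\nu_p$ is the $p$-adic valuation. $f$ is called $k$-power-free if each nonconstant irreducible factor of $f$ occurs with multiplicity at most $k-1$ in the factorization of $f$ (equivalently, no $g^k$ with $g$ a nonconstant Dirichlet polynomial over $R$ divides $f$). *)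

theory Defs
  imports "HOL-Computational_Algebra.Primes"
begin

section \<open>Dirichlet polynomials\<close>

text \<open>
  A Dirichlet polynomial \<open>\<Sum>\<^sub>i a\<^sub>i / i\<^sup>s\<close> is a formal object, given by its coefficients. The index
  runs over the positive integers, so the coefficient at the dummy index 0 is required to vanish.
\<close>

typedef (overloaded) 'a dirichlet_poly =
    "{a :: nat \<Rightarrow> 'a::zero. finite {i. a i \<noteq> 0} \<and> a 0 = 0}"
  morphisms dcoeff Abs_dirichlet_poly
  by (rule exI[of _ "\<lambda>_. 0"]) simp

setup_lifting type_definition_dirichlet_poly

lemma dcoeff_0 [simp]: "dcoeff f 0 = 0"
  by transfer simp

lemma dirichlet_poly_eqI: "(\<And>i. i > 0 \<Longrightarrow> dcoeff f i = dcoeff g i) \<Longrightarrow> f = g"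
  by (metis dcoeff_0 dcoeff_inject ext gr0I)

lemma finite_dcoeff [simp]: "finite {i. dcoeff f i \<noteq> 0}"
  by transfer simp

lemma finite_mult_pairs: "i > 0 \<Longrightarrow> finite {(j, k). j * k = (i::nat)}"
  by (rule finite_subset[of _ "{..i} \<times> {..i}"]) auto

instantiation dirichlet_poly :: (zero) zero
begin
lift_definition zero_dirichlet_poly :: "'a dirichlet_poly" is "\<lambda>_. 0" by simp
instance ..
end

text \<open>
  In the product below, the set of pairs is infinite for \<open>i = 0\<close>, and the sum over it is 0, as
  required.
\<close>

instantiation dirichlet_poly :: (comm_ring_1) comm_ring_1
begin

lift_definition one_dirichlet_poly :: "'a dirichlet_poly" is "\<lambda>i. if i = 1 then 1 else 0"
  by simp

lift_definition plus_dirichlet_poly ::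
  "'a dirichlet_poly \<Rightarrow> 'a dirichlet_poly \<Rightarrow> 'a dirichlet_poly" is "\<lambda>a b i. a i + b i"
proof -
  fix a b :: "nat \<Rightarrow> 'a"
  assume "finite {i. a i \<noteq> 0} \<and> a 0 = 0" "finite {i. b i \<noteq> 0} \<and> b 0 = 0"
  moreover have "{i. a i + b i \<noteq> 0} \<subseteq> {i. a i \<noteq> 0} \<union> {i. b i \<noteq> 0}" by auto
  ultimately show "finite {i. a i + b i \<noteq> 0} \<and> a 0 + b 0 = 0"
    using finite_subset by auto
qed

lift_definition uminus_dirichlet_poly :: "'a dirichlet_poly \<Rightarrow> 'a dirichlet_poly"
  is "\<lambda>a i. - a i" by simp

lift_definition minus_dirichlet_poly ::
  "'a dirichlet_poly \<Rightarrow> 'a dirichlet_poly \<Rightarrow> 'a dirichlet_poly" is "\<lambda>a b i. a i - b i"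
proof -
  fix a b :: "nat \<Rightarrow> 'a"
  assume "finite {i. a i \<noteq> 0} \<and> a 0 = 0" "finite {i. b i \<noteq> 0} \<and> b 0 = 0"
  moreover have "{i. a i - b i \<noteq> 0} \<subseteq> {i. a i \<noteq> 0} \<union> {i. b i \<noteq> 0}" by auto
  ultimately show "finite {i. a i - b i \<noteq> 0} \<and> a 0 - b 0 = 0"
    using finite_subset by auto
qed

lift_definition times_dirichlet_poly ::
  "'a dirichlet_poly \<Rightarrow> 'a dirichlet_poly \<Rightarrow> 'a dirichlet_poly"
  is "\<lambda>b c i. \<Sum>(j, k) | j * k = i. b j * c k"
proof -
  fix a b :: "nat \<Rightarrow> 'a"
  assume ab: "finite {i. a i \<noteq> 0} \<and> a 0 = 0" "finite {i. b i \<noteq> 0} \<and> b 0 = 0"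
  have "{i. (\<Sum>(j, k) | j * k = i. a j * b k) \<noteq> 0}
          \<subseteq> (\<lambda>(j, k). j * k) ` ({i. a i \<noteq> 0} \<times> {i. b i \<noteq> 0})"
  proof
    fix i assume "i \<in> {i. (\<Sum>(j, k) | j * k = i. a j * b k) \<noteq> 0}"
    then obtain p where "p \<in> {(j, k). j * k = i}" "(case p of (j, k) \<Rightarrow> a j * b k) \<noteq> 0"
      by (metis (mono_tags, lifting) mem_Collect_eq sum.not_neutral_contains_not_neutral)
    then have "a (fst p) \<noteq> 0" "b (snd p) \<noteq> 0" "i = fst p * snd p" by auto
    then show "i \<in> (\<lambda>(j, k). j * k) ` ({i. a i \<noteq> 0} \<times> {i. b i \<noteq> 0})"
      by (intro image_eqI[of _ _ p]) (auto simp: case_prod_unfold mem_Times_iff)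
  qed
  moreover have "(\<Sum>(j, k) | j * k = 0. a j * b k) = 0"
    by (rule sum.neutral) (use ab in auto)
  ultimately show "finite {i. (\<Sum>(j, k) | j * k = i. a j * b k) \<noteq> 0}
      \<and> (\<Sum>(j, k) | j * k = 0. a j * b k) = 0"
    using ab by (meson finite_SigmaI finite_imageI finite_subset)
qed

lemma dcoeff_mult: "dcoeff (f * g) i = (\<Sum>(j, k) | j * k = i. dcoeff f j * dcoeff g k)"
  by transfer simp

instance
proof
  fix f g h :: "'a dirichlet_poly"
  show "f + g + h = f + (g + h)" by transfer (simp add: add.assoc)
  show "f + g = g + f" by transfer (simp add: add.commute)
  show "0 + f = f" by transfer simp
  show "- f + f = 0" by transfer simp
  show "f - g = f + - g" by transfer simp
  show "(0 :: 'a dirichlet_poly) \<noteq> 1" by transfer (metis zero_neq_one)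
  show "f * g = g * f"
  proof (rule dirichlet_poly_eqI)
    fix i :: nat
    show "dcoeff (f * g) i = dcoeff (g * f) i"
      unfolding dcoeff_mult
      by (rule sum.reindex_bij_witness[of _ prod.swap prod.swap]) (auto simp: mult.commute)
  qed
  show "(f + g) * h = f * h + g * h"
    by transfer (simp add: distrib_right sum.distrib case_prod_unfold)
  show "1 * f = f"
  proof (rule dirichlet_poly_eqI)
    fix i :: nat assume i: "i > 0"
    have "dcoeff (1 * f) i = (\<Sum>(j, k) | j * k = i. dcoeff 1 j * dcoeff f k)"
      by (rule dcoeff_mult)
    also have "\<dots> = (\<Sum>(j, k) \<in> {(1, i)}. dcoeff 1 j * dcoeff f k)"
      by (rule sum.mono_neutral_right[OF finite_mult_pairs[OF i]])
         (auto simp: one_dirichlet_poly.rep_eq split: if_splits)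
    finally show "dcoeff (1 * f) i = dcoeff f i"
      by (simp add: one_dirichlet_poly.rep_eq)
  qed
  show "f * g * h = f * (g * h)"
  proof (rule dirichlet_poly_eqI)
    fix i :: nat assume i: "i > 0"
    let ?a = "dcoeff f" and ?b = "dcoeff g" and ?c = "dcoeff h"
    let ?S = "\<lambda>i. {(j, k). j * k = (i::nat)}"
    have fin: "finite (?S i)" by (rule finite_mult_pairs[OF i])
    have fin': "\<forall>p \<in> ?S i. finite (?S (fst p))" "\<forall>p \<in> ?S i. finite (?S (snd p))"
      using i by (auto intro!: finite_mult_pairs)
    have "dcoeff (f * g * h) i = (\<Sum>p\<in>?S i. \<Sum>q\<in>?S (fst p). ?a (fst q) * ?b (snd q) * ?c (snd p))"
      by (simp add: dcoeff_mult case_prod_unfold sum_distrib_right)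
    also have "\<dots> = (\<Sum>(p, q)\<in>(SIGMA p:?S i. ?S (fst p)). ?a (fst q) * ?b (snd q) * ?c (snd p))"
      by (rule sum.Sigma[OF fin fin'(1)])
    also have "\<dots> = (\<Sum>(p, q)\<in>(SIGMA p:?S i. ?S (snd p)). ?a (fst p) * (?b (fst q) * ?c (snd q)))"
      by (rule sum.reindex_bij_witness[of _
            "\<lambda>((x, y), (u, v)). ((x * u, v), (x, u))" "\<lambda>((x, y), (u, v)). ((u, v * y), (v, y))"])
         (auto simp: mult.assoc)
    also have "\<dots> = (\<Sum>p\<in>?S i. \<Sum>q\<in>?S (snd p). ?a (fst p) * (?b (fst q) * ?c (snd q)))"
      by (rule sum.Sigma[OF fin fin'(2), symmetric])
    also have "\<dots> = dcoeff (f * (g * h)) i"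
      by (simp add: dcoeff_mult case_prod_unfold sum_distrib_left)
    finally show "dcoeff (f * g * h) i = dcoeff (f * (g * h)) i" .
  qed
qed

end

definition ddegree :: "'a::zero dirichlet_poly \<Rightarrow> nat" where
  "ddegree f = (if f = 0 then 0 else Max {i. dcoeff f i \<noteq> 0})"

definition dconstant :: "'a::zero dirichlet_poly \<Rightarrow> bool" where
  "dconstant f \<longleftrightarrow> {i. dcoeff f i \<noteq> 0} \<subseteq> {1}"

lemma dcoeff_zero [simp]: "dcoeff 0 i = 0"
  by transfer simp

lemma dcoeff_neq_0_imp_le: "dcoeff f i \<noteq> 0 \<Longrightarrow> i \<le> ddegree f"
  by (auto simp: ddegree_def)

lemma lead_dcoeff_neq_0: 
  assumes "f \<noteq> 0" shows "dcoeff f (ddegree f) \<noteq> 0"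
proof -
  have "{i. dcoeff f i \<noteq> 0} \<noteq> {}"
    using assms dirichlet_poly_eqI[of f 0] by auto
  from Max_in[OF finite_dcoeff this] show ?thesis
    using assms by (simp add: ddegree_def)
qed

lemma ddegree_pos: "f \<noteq> 0 \<Longrightarrow> ddegree f > 0"
  using lead_dcoeff_neq_0[of f] by (metis dcoeff_0 gr0I)

lemma dconstant_iff_ddegree: "dconstant f \<longleftrightarrow> ddegree f \<le> 1"
proof
  show "dconstant f \<Longrightarrow> ddegree f \<le> 1"
    using lead_dcoeff_neq_0[of f] by (cases "f = 0") (auto simp: dconstant_def ddegree_def)
next
  assume d: "ddegree f \<le> 1"
  have "i = 1" if "dcoeff f i \<noteq> 0" for i
    using dcoeff_neq_0_imp_le[OF that] d that by (cases "i = 0") auto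
  then show "dconstant f" by (auto simp: dconstant_def)
qed

lemma dcoeff_mult_ddegree:
  fixes f g :: "'a::comm_ring_1 dirichlet_poly"
  assumes "f \<noteq> 0" "g \<noteq> 0"
  shows "dcoeff (f * g) (ddegree f * ddegree g) = dcoeff f (ddegree f) * dcoeff g (ddegree g)"
proof -
  let ?m = "ddegree f" and ?n = "ddegree g"
  have pos: "?m > 0" "?n > 0" using assms by (simp_all add: ddegree_pos)
  have "dcoeff (f * g) (?m * ?n) = (\<Sum>(j, k) \<in> {(?m, ?n)}. dcoeff f j * dcoeff g k)"
    unfolding dcoeff_mult
  proof (rule sum.mono_neutral_right)
    show "finite {(j, k). j * k = ?m * ?n}"
      by (rule finite_mult_pairs) (use pos in simp)
    show "\<forall>p\<in>{(j, k). j * k = ?m * ?n} - {(?m, ?n)}. (case p of (j, k) \<Rightarrow> dcoeff f j * dcoeff g k) = 0"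
    proof
      fix p assume "p \<in> {(j, k). j * k = ?m * ?n} - {(?m, ?n)}"
      then obtain j k where jk: "p = (j, k)" "j * k = ?m * ?n" "(j, k) \<noteq> (?m, ?n)" by auto
      have "dcoeff f j * dcoeff g k = 0"
      proof (rule ccontr)
        assume "dcoeff f j * dcoeff g k \<noteq> 0"
        then have "dcoeff f j \<noteq> 0" "dcoeff g k \<noteq> 0" by auto
        then have "j \<le> ?m" "k \<le> ?n" by (auto dest: dcoeff_neq_0_imp_le)
        moreover from this have "?m * ?n \<le> ?m * k" "?m * ?n \<le> j * ?n"
          using jk(2) mult_le_mono1[of j ?m k] mult_le_mono2[of k ?n j] by simp_all
        ultimately have "j = ?m" "k = ?n" using pos by auto
        with jk(3) show False by simp
      qed
      then show "(case p of (j, k) \<Rightarrow> dcoeff f j * dcoeff g k) = 0" by (simp add: jk(1))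
    qed
  qed auto
  then show ?thesis by simp
qed

instance dirichlet_poly :: (idom) idom
proof
  fix f g :: "'a dirichlet_poly"
  assume "f \<noteq> 0" "g \<noteq> 0"
  then have "dcoeff (f * g) (ddegree f * ddegree g) \<noteq> 0"
    by (simp add: dcoeff_mult_ddegree lead_dcoeff_neq_0)
  then show "f * g \<noteq> 0" by auto
qed

lemma ddegree_mult:
  fixes f g :: "'a::idom dirichlet_poly"
  assumes "f \<noteq> 0" "g \<noteq> 0"
  shows "ddegree (f * g) = ddegree f * ddegree g"
proof (rule antisym)
  show "ddegree f * ddegree g \<le> ddegree (f * g)"
    by (rule dcoeff_neq_0_imp_le) (simp add: assms dcoeff_mult_ddegree lead_dcoeff_neq_0)
  have "dcoeff (f * g) (ddegree (f * g)) \<noteq> 0"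
    using assms by (intro lead_dcoeff_neq_0) simp
  then obtain p where p: "p \<in> {(j, k). j * k = ddegree (f * g)}"
      "(case p of (j, k) \<Rightarrow> dcoeff f j * dcoeff g k) \<noteq> 0"
    unfolding dcoeff_mult by (metis (mono_tags, lifting) sum.not_neutral_contains_not_neutral)
  obtain j k where jk: "p = (j, k)" by (cases p)
  with p have "dcoeff f j \<noteq> 0" "dcoeff g k \<noteq> 0" "j * k = ddegree (f * g)" by auto
  then show "ddegree (f * g) \<le> ddegree f * ddegree g"
    using dcoeff_neq_0_imp_le[of f j] dcoeff_neq_0_imp_le[of g k]
      mult_le_mono[of j "ddegree f" k "ddegree g"] by simp
qed

lemma ddegree_power: "g \<noteq> 0 \<Longrightarrow> ddegree (g ^ m) = ddegree (g :: 'a::idom dirichlet_poly) ^ m"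
proof (induction m)
  case 0
  have "dcoeff (1 :: 'a dirichlet_poly) i \<noteq> 0 \<longleftrightarrow> i = 1" for i
    by (simp add: one_dirichlet_poly.rep_eq)
  then show ?case by (simp add: ddegree_def)
qed (simp add: ddegree_mult)


section \<open>Power-freeness\<close>

text \<open>
  The library constant \<^const>\<open>multiplicity\<close> is only available for types of class
  \<^class>\<open>factorial_semiring\<close>; the following is its definition, used for Dirichlet polynomials.
  The set is finite for \<open>f \<noteq> 0\<close> and nonconstant \<open>g\<close> (see \<open>power_dvd_iff_le_dmultiplicity\<close>
  below). The zero polynomial, which has no factorization, is not \<open>k\<close>-power-free.
\<close>

definition dmultiplicity :: "'a::idom dirichlet_poly \<Rightarrow> 'a dirichlet_poly \<Rightarrow> nat" where
  "dmultiplicity g f = (if finite {m. g ^ m dvd f} then Max {m. g ^ m dvd f} else 0)"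

definition power_free :: "nat \<Rightarrow> 'a::idom dirichlet_poly \<Rightarrow> bool" where
  "power_free k f \<longleftrightarrow> f \<noteq> 0 \<and>
     (\<forall>g. irreducible g \<and> \<not> dconstant g \<and> g dvd f \<longrightarrow> dmultiplicity g f \<le> k - 1)"

lemma power_dvd_iff_le_dmultiplicity:
  assumes "f \<noteq> 0" "\<not> dconstant g"
  shows "g ^ m dvd f \<longleftrightarrow> m \<le> dmultiplicity g f"
proof -
  have g: "g \<noteq> 0" "ddegree g \<ge> 2"
    using assms(2) by (auto simp: dconstant_iff_ddegree ddegree_def)
  have "m \<le> ddegree f" if "g ^ m dvd f" for m
  proof -
    from that obtain h where h: "f = g ^ m * h" ..
    with assms(1) have "h \<noteq> 0" by auto
    have "m \<le> 2 ^ m" by (simp add: less_imp_le)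
    also have "\<dots> \<le> ddegree g ^ m" using g by (simp add: power_mono)
    also have "\<dots> \<le> ddegree g ^ m * ddegree h" using ddegree_pos[OF \<open>h \<noteq> 0\<close>] by simp
    also have "\<dots> = ddegree f" using g \<open>h \<noteq> 0\<close> by (simp add: h ddegree_mult ddegree_power)
    finally show ?thesis .
  qed
  then have "{m. g ^ m dvd f} \<subseteq> {..ddegree f}" by auto
  then have fin: "finite {m. g ^ m dvd f}" by (rule finite_subset) simp
  show ?thesis
  proof
    show "g ^ m dvd f \<Longrightarrow> m \<le> dmultiplicity g f"
      using fin by (simp add: dmultiplicity_def)
  next
    assume m: "m \<le> dmultiplicity g f"
    have "0 \<in> {m. g ^ m dvd f}" by simp
    then have "Max {m. g ^ m dvd f} \<in> {m. g ^ m dvd f}" using Max_in[OF fin] by blast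
    then have "g ^ dmultiplicity g f dvd f" using fin by (simp add: dmultiplicity_def)
    with m show "g ^ m dvd f" by (meson dvd_trans le_imp_power_dvd)
  qed
qed

lift_definition dconst :: "'a::zero \<Rightarrow> 'a dirichlet_poly" is "\<lambda>c i. if i = 1 then c else 0"
  by simp

lemma dconst_unit:
  fixes c :: "'a::comm_ring_1"
  assumes "c dvd 1" shows "dconst c dvd 1"
proof -
  from assms obtain d where d: "1 = c * d" ..
  have "1 = dconst c * dconst d"
  proof (rule dirichlet_poly_eqI)
    fix i :: nat assume i: "i > 0"
    have "dcoeff (dconst c * dconst d) i
        = (\<Sum>(j, k) \<in> (if i = 1 then {(1, 1)} else {}). dcoeff (dconst c) j * dcoeff (dconst d) k)"
      unfolding dcoeff_mult
      by (rule sum.mono_neutral_right[OF finite_mult_pairs[OF i]])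
         (auto simp: dconst.rep_eq)
    then show "dcoeff 1 i = dcoeff (dconst c * dconst d) i"
      by (simp add: dconst.rep_eq one_dirichlet_poly.rep_eq d[symmetric])
  qed
  then show ?thesis ..
qed

lemma nonconstant_has_irreducible_factor:
  fixes g :: "'a::{idom, factorial_semiring} dirichlet_poly"
  assumes "g \<noteq> 0" "\<not> dconstant g"
  shows "\<exists>h. irreducible h \<and> \<not> dconstant h \<and> h dvd g"
  using assms
proof (induction "ddegree g + size (prime_factorization (dcoeff g (ddegree g)))"
    arbitrary: g rule: less_induct)
  case less
  let ?\<mu> = "\<lambda>g :: 'a dirichlet_poly. ddegree g + size (prime_factorization (dcoeff g (ddegree g)))"
  have step: ?case if ab: "g = a * b" "\<not> a dvd 1" "\<not> dconstant b" for a b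
  proof -
    have nz: "a \<noteq> 0" "b \<noteq> 0" using less.prems ab by auto
    have lc: "dcoeff g (ddegree g) = dcoeff a (ddegree a) * dcoeff b (ddegree b)"
      using nz by (simp add: ab ddegree_mult dcoeff_mult_ddegree)
    show ?thesis
    proof (cases "dconstant a")
      case True
      then have d: "ddegree a = 1"
        using ddegree_pos[OF nz(1)] by (simp add: dconstant_iff_ddegree)
      have "a = dconst (dcoeff a 1)"
        using True by (intro dirichlet_poly_eqI) (auto simp: dconst.rep_eq dconstant_def)
      then have "\<not> dcoeff a 1 dvd 1" using ab(2) dconst_unit by metis
      then have "prime_factorization (dcoeff a 1) \<noteq> {#}"
        using lead_dcoeff_neq_0[OF nz(1)] by (simp add: d prime_factorization_empty_iff)
      then have "size (prime_factorization (dcoeff b (ddegree b)))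
          < size (prime_factorization (dcoeff g (ddegree g)))"
        using lead_dcoeff_neq_0[OF nz(1)] lead_dcoeff_neq_0[OF nz(2)]
        unfolding lc by (simp add: prime_factorization_mult d nonempty_has_size)
      moreover have "ddegree g = ddegree b" using nz by (simp add: ab ddegree_mult d)
      ultimately have "?\<mu> b < ?\<mu> g" by simp
      from less.hyps[OF this nz(2) ab(3)] show ?thesis
        unfolding ab by (meson dvd_mult)
    next
      case False
      then have "ddegree a > 1" by (simp add: dconstant_iff_ddegree)
      then have lt: "ddegree b < ddegree g"
        using ddegree_pos[OF nz(2)] nz by (simp add: ab ddegree_mult)
      have "prime_factorization (dcoeff b (ddegree b)) \<subseteq># prime_factorization (dcoeff g (ddegree g))"
        using lead_dcoeff_neq_0[OF nz(1)] lead_dcoeff_neq_0[OF nz(2)]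
        unfolding lc by (simp add: prime_factorization_mult)
      then have "?\<mu> b < ?\<mu> g" using lt size_mset_mono by fastforce
      from less.hyps[OF this nz(2) ab(3)] show ?thesis
        unfolding ab by (meson dvd_mult)
    qed
  qed
  show ?case
  proof (cases "irreducible g")
    case True
    then show ?thesis using less.prems(2) dvd_refl[of g] by iprover
  next
    case False
    have "\<not> g dvd 1"
    proof
      assume "g dvd 1"
      then obtain h where "1 = g * h" ..
      then have "h \<noteq> 0" by auto
      then have "ddegree g * ddegree h = 1"
        using ddegree_mult[OF less.prems(1), of h] ddegree_power[OF less.prems(1), of 0]
        by (simp flip: \<open>1 = g * h\<close>)
      then show False using less.prems by (simp add: dconstant_iff_ddegree)
    qed
    with False less.prems obtain a b where ab: "g = a * b" "\<not> a dvd 1" "\<not> b dvd 1"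
      by (auto simp: irreducible_def)
    then have nz: "a \<noteq> 0" "b \<noteq> 0" using less.prems by auto
    have "\<not> dconstant a \<or> \<not> dconstant b"
      using less.prems nz ddegree_pos[of a] ddegree_pos[of b]
      by (auto simp: dconstant_iff_ddegree ab(1) ddegree_mult le_Suc_eq)
    moreover have "g = b * a" using ab(1) by (simp add: mult.commute)
    ultimately show ?thesis using step[of a b] step[of b a] ab by argo
  qed
qed

text \<open>
  Over a unique factorization domain, power-freeness can equivalently be tested on all nonconstant
  Dirichlet polynomials instead of the irreducible ones. A unique factorization domain is a type of
  sort \<open>{idom, factorial_semiring}\<close>; the choice of normalized associates that comes with the class
  exists on every unique factorization domain and plays no role in the notions defined here.
\<close>

lemma power_free_iff:
  fixes f :: "'a::{idom, factorial_semiring} dirichlet_poly"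
  assumes "k \<ge> 1" "f \<noteq> 0"
  shows "power_free k f \<longleftrightarrow> (\<forall>g. \<not> dconstant g \<longrightarrow> \<not> g ^ k dvd f)"
proof
  assume pf: "power_free k f"
  show "\<forall>g. \<not> dconstant g \<longrightarrow> \<not> g ^ k dvd f"
  proof (intro allI impI notI)
    fix g assume g: "\<not> dconstant g" "g ^ k dvd f"
    then have "g \<noteq> 0" by (auto simp: dconstant_def)
    from nonconstant_has_irreducible_factor[OF this g(1)]
    obtain h where h: "irreducible h" "\<not> dconstant h" "h dvd g" by blast
    then have hk: "h ^ k dvd f" using g(2) by (meson dvd_power_same dvd_trans)
    then have "h dvd f" using assms(1) by (meson dvd_power dvd_trans less_le_trans zero_less_one)
    then have "dmultiplicity h f \<le> k - 1" using pf h by (auto simp: power_free_def)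
    then show False using hk power_dvd_iff_le_dmultiplicity[OF assms(2) h(2), of k] assms(1) by simp
  qed
next
  assume *: "\<forall>g. \<not> dconstant g \<longrightarrow> \<not> g ^ k dvd f"
  show "power_free k f"
    unfolding power_free_def
  proof (intro conjI allI impI)
    fix g assume "irreducible g \<and> \<not> dconstant g \<and> g dvd f"
    then show "dmultiplicity g f \<le> k - 1"
      using * power_dvd_iff_le_dmultiplicity[OF assms(2), of g k] by fastforce
  qed (rule assms(2))
qed


section \<open>The quantities attached to the degree\<close>

text \<open>
  These are \<open>n\<^bsub><k\<^esub>\<close> and \<open>q\<^sub>k\<close>. Primes not dividing \<open>n\<close> would contribute a factor 1 to the former.
\<close>

definition part_below :: "nat \<Rightarrow> nat \<Rightarrow> nat" where
  "part_below k n = (\<Prod>p | p \<in> prime_factors n \<and> multiplicity p n < k. p ^ multiplicity p n)"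

definition least_prime_ge :: "nat \<Rightarrow> nat \<Rightarrow> nat" where
  "least_prime_ge k n = Min {p \<in> prime_factors n. k \<le> multiplicity p n}"

end

theory Submission
  imports Defs
begin

text \<open>
  If \<open>f = g\<^sup>k h\<close> with \<open>deg g = d \<ge> 2\<close> and \<open>deg h = e\<close>, then every index \<open>i < n = d\<^sup>k e\<close> of \<open>f\<close>
  is a product of \<open>k\<close> indices of \<open>g\<close> and one index of \<open>h\<close>, not all of them maximal. Lowering an
  index of \<open>g\<close> costs at least \<open>d\<^bsup>k-1\<^esup> e\<close>, lowering the index of \<open>h\<close> costs at least \<open>d\<^sup>k\<close>. Every
  prime factor of \<open>d\<close> has multiplicity at least \<open>k\<close> in \<open>n\<close>; hence \<open>d \<ge> q\<^sub>k\<close>, and \<open>n\<^bsub><k\<^esub>\<close> is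
  coprime to \<open>d\<close>, so it divides \<open>e\<close>.
\<close>

lemma dcoeff_mult_neq_0E:
  assumes "dcoeff (f * g) i \<noteq> 0"
  obtains j l where "i = j * l" "dcoeff f j \<noteq> 0" "dcoeff g l \<noteq> 0"
proof -
  from assms obtain p where "p \<in> {(j, l). j * l = i}"
      "(case p of (j, l) \<Rightarrow> dcoeff f j * dcoeff g l) \<noteq> 0"
    unfolding dcoeff_mult by (metis (mono_tags, lifting) sum.not_neutral_contains_not_neutral)
  moreover obtain j l where "p = (j, l)" by (cases p)
  ultimately have "i = j * l" "dcoeff f j \<noteq> 0" "dcoeff g l \<noteq> 0" by auto
  then show thesis by (rule that)
qed

text \<open>The bound is \<open>i \<le> d\<^sup>m - d\<^bsup>m-1\<^esup>\<close>, multiplied by \<open>d\<close> to include \<open>m = 0\<close>.\<close>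

lemma dcoeff_power_gap:
  fixes g :: "'a::idom dirichlet_poly"
  assumes "dcoeff (g ^ m) i \<noteq> 0" "i \<noteq> ddegree g ^ m"
  shows "ddegree g * i \<le> (ddegree g - 1) * ddegree g ^ m"
  using assms
proof (induction m arbitrary: i)
  case 0
  \<comment> \<open>The only nonzero coefficient of \<open>g ^ 0 = 1\<close> sits at index 1 =
    \<open>ddegree g ^ 0\<close>, which is excluded.\<close>
  then show ?case by (simp add: one_dirichlet_poly.rep_eq split: if_splits)
next
  case (Suc m)
  let ?d = "ddegree g"
  from Suc.prems(1) obtain j l where jl: "i = j * l" "dcoeff g j \<noteq> 0" "dcoeff (g ^ m) l \<noteq> 0"
    by (auto elim: dcoeff_mult_neq_0E)
  have "g \<noteq> 0" using jl(2) by auto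
  then have l: "l \<le> ?d ^ m" using dcoeff_neq_0_imp_le[OF jl(3)] by (simp add: ddegree_power)
  have j: "j \<le> ?d" using jl(2) by (rule dcoeff_neq_0_imp_le)
  show ?case
  proof (cases "l = ?d ^ m")
    case True
    \<comment> \<open>With \<open>l\<close> maximal, the loss must come from \<open>j\<close>, which
      drops by at least 1.\<close>
    with Suc.prems(2) jl(1) j have "j \<le> ?d - 1" by (cases "j = ?d") auto
    then have "?d * (j * l) \<le> ?d * ((?d - 1) * ?d ^ m)"
      using l by (intro mult_le_mono) auto
    then show ?thesis by (simp add: jl(1) mult_ac)
  next
    case False
    \<comment> \<open>Here \<open>l\<close> already carries the loss, so the trivial bound
      \<open>j \<le> ?d\<close> suffices.\<close>
    then have "j * (?d * l) \<le> ?d * ((?d - 1) * ?d ^ m)"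
      by (rule mult_le_mono[OF j Suc.IH[OF jl(3)]])
    then show ?thesis by (simp add: jl(1) mult_ac)
  qed
qed

lemma le_multiplicity_of_power_dvd:
  fixes p d n :: nat
  assumes "d ^ k dvd n" "n > 0" "prime p" "p dvd d"
  shows "k \<le> multiplicity p n"
proof -
  have "p ^ k dvd n" using assms by (meson dvd_power_same dvd_trans)
  then show ?thesis using assms by (intro multiplicity_geI) auto
qed

text \<open>Any prime factor of \<open>d\<close> competes in the minimum defining
  \<open>least_prime_ge k n\<close>.\<close>

lemma least_prime_ge_le_of_power_dvd:
  assumes "d ^ k dvd n" "n > 0" "d > 1" "k > 0"
  shows "least_prime_ge k n \<le> d"
proof -
  obtain p where p: "prime p" "p dvd d" using assms(3) prime_factor_nat[of d] by auto
  then have "p dvd n" using assms by (meson dvd_power dvd_trans)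
  then have "p \<in> {p \<in> prime_factors n. k \<le> multiplicity p n}"
    using p le_multiplicity_of_power_dvd[OF assms(1,2) p] assms(2)
    by (auto simp: in_prime_factors_iff)
  then have "least_prime_ge k n \<le> p" unfolding least_prime_ge_def by (intro Min_le) auto
  also have "p \<le> d" using p assms(3) by (intro dvd_imp_le) auto
  finally show ?thesis .
qed

lemma part_below_dvd: "part_below k n dvd n"
proof (cases "n = 0")
  case False
  have "part_below k n dvd (\<Prod>p\<in>prime_factors n. p ^ multiplicity p n)"
    unfolding part_below_def by (rule prod_dvd_prod_subset) auto
  then show ?thesis using False by (simp flip: prime_factorization_nat)
qed simp

lemma part_below_dvd_cofactor:
  assumes "n = d ^ k * e" "n > 0"
  shows "part_below k n dvd e"
proof -
  have "coprime p d" if "p \<in> prime_factors n" "multiplicity p n < k" for p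
    using le_multiplicity_of_power_dvd[of d k n p] assms that
    by (intro prime_imp_coprime) (auto simp: in_prime_factors_iff)
  then have "coprime (part_below k n) (d ^ k)"
    unfolding part_below_def by (intro coprime_power_right_iff[THEN iffD2] disjI1 prod_coprime_left)
      (auto simp: coprime_power_left_iff)
  then show ?thesis using part_below_dvd[of k n] assms(1)
    by (metis coprime_dvd_mult_right_iff)
qed

text \<open>The entries of the minimum are the losses when the index from \<open>g ^ k\<close>, or
  only the index from \<open>h\<close>, is not maximal. The additive form avoids truncated
  subtraction.\<close>

lemma dcoeff_mult_power_gap:
  fixes g h :: "'a::idom dirichlet_poly"
  assumes "dcoeff (g ^ k * h) i \<noteq> 0" "i \<noteq> ddegree g ^ k * ddegree h" "k > 0"
  shows "i + min (ddegree g ^ (k - 1) * ddegree h) (ddegree g ^ k) \<le> ddegree g ^ k * ddegree h"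
proof -
  let ?d = "ddegree g" and ?e = "ddegree h"
  obtain j l where jl: "i = j * l" "dcoeff (g ^ k) j \<noteq> 0" "dcoeff h l \<noteq> 0"
    using assms(1) by (rule dcoeff_mult_neq_0E)
  have "g \<noteq> 0" using jl(2) assms(3) by (auto simp: power_0_left)
  then have d: "?d > 0" by (rule ddegree_pos)
  have k: "?d ^ k = ?d * ?d ^ (k - 1)" using assms(3) by (simp add: power_eq_if)
  have l: "l \<le> ?e" using jl(3) by (rule dcoeff_neq_0_imp_le)
  show ?thesis
  proof (cases "j = ?d ^ k")
    case True
    with assms(2) jl(1) l have "l + 1 \<le> ?e" by (cases "l = ?e") auto
    then have "?d ^ k * (l + 1) \<le> ?d ^ k * ?e" by (rule mult_le_mono2)
    then show ?thesis using True jl(1) by simp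
  next
    case False
    \<comment> \<open>The extra factor \<open>?d\<close> in \<open>dcoeff_power_gap\<close> is
      matched by one split off \<open>?d ^ k\<close>, as \<open>k > 0\<close>, and then
      cancelled.\<close>
    then have "?d * j \<le> ?d * ((?d - 1) * ?d ^ (k - 1))"
      using dcoeff_power_gap[OF jl(2)] by (simp add: k mult_ac)
    then have "j \<le> (?d - 1) * ?d ^ (k - 1)" using d by simp
    then have "i \<le> (?d - 1) * ?d ^ (k - 1) * ?e" unfolding jl(1) using l by (rule mult_le_mono)
    moreover have "(?d - 1) * ?d ^ (k - 1) * ?e + ?d ^ (k - 1) * ?e = ?d ^ k * ?e"
      unfolding k using d by (cases ?d) (simp_all add: algebra_simps)
    ultimately show ?thesis by simp
  qed
qed

theorem theorem7p3:
  fixes f :: "'a :: {idom, factorial_semiring} dirichlet_poly"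
    and k n :: nat
  assumes "2 \<le> k"
    and "\<exists>p \<in> prime_factors n. k \<le> multiplicity p n"
    and "ddegree f = n"
    and "\<exists>i. dcoeff f i \<noteq> 0
           \<and> int n - int (min (part_below k n) (least_prime_ge k n) * least_prime_ge k n ^ (k - 1))
               < int i
           \<and> i < n"
  shows "power_free k f"
proof -
  let ?q = "least_prime_ge k n" and ?r = "part_below k n"
  from assms(4) obtain i where i: "dcoeff f i \<noteq> 0"
      "int n - int (min ?r ?q * ?q ^ (k - 1)) < int i" "i < n" by blast
  have f: "f \<noteq> 0" using i(1) by auto
  have n: "n > 0" using i(3) by simp
  have "\<not> g ^ k dvd f" if g: "\<not> dconstant g" for g
  proof
    assume "g ^ k dvd f"
    then obtain h where h: "f = g ^ k * h" ..
    let ?d = "ddegree g" and ?e = "ddegree h"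
    have nz: "g \<noteq> 0" "h \<noteq> 0" using f h assms(1) by (auto simp: power_0_left)
    have n_eq: "n = ?d ^ k * ?e" using nz assms(3) by (simp add: h ddegree_mult ddegree_power)
    have q: "?q \<le> ?d"
      using g n_eq n assms(1) by (intro least_prime_ge_le_of_power_dvd) (auto simp: dconstant_iff_ddegree)
    have r: "?r \<le> ?e"
      using part_below_dvd_cofactor[OF n_eq n] ddegree_pos[OF nz(2)] by (rule dvd_imp_le)
    \<comment> \<open>The factor \<open>min ?r ?q\<close> is bounded through
      \<open>?r \<le> ?e\<close> for one loss and through \<open>?q \<le> ?d\<close> for the
      other.\<close>
    have "min ?r ?q * ?q ^ (k - 1) \<le> ?e * ?d ^ (k - 1)"
      using q r by (intro mult_le_mono power_mono) auto
    moreover have "min ?r ?q * ?q ^ (k - 1) \<le> ?d * ?d ^ (k - 1)"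
      using q by (intro mult_le_mono power_mono) auto
    moreover have "?d * ?d ^ (k - 1) = ?d ^ k" using assms(1) by (simp add: power_eq_if)
    ultimately have "min ?r ?q * ?q ^ (k - 1) \<le> min (?d ^ (k - 1) * ?e) (?d ^ k)"
      by (simp add: mult.commute)
    \<comment> \<open>Since \<open>i < n\<close>, the gap applies, and it is at least as wide as the
      window below \<open>n\<close> that contains \<open>i\<close>.\<close>
    also have "i + \<dots> \<le> n"
      unfolding n_eq by (rule dcoeff_mult_power_gap) (use i n_eq h assms(1) in auto)
    finally show False using i(2) by linarith
  qed
  then show ?thesis using power_free_iff[of k f] f assms(1) by auto
qed

end
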